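(* Let $m$ be a positive integer and let \[ S_{2m+1}(x)=\sum_{s=0}^m x^{2s+1}\left(\sum_{k=s}^m \frac{1+2k}{1+2s}\binom{2m+1}{m-k}\binom{k+s}{2s}\frac{(-5)^{s-m}}{L_{2k+1}}\right)-\sum_{k=0}^m (-1)^{m-k}\binom{2m+1}{m-k}\frac{F_{2k+1}}{L_{2k+1}}5^{-m}. \] Then the polynomial $L_1L_3L_5\cdots L_{2m+1}S_{2m+1}(x)$ has only integer coefficients.
   Context: $F_n$ and $L_n$ are the Fibonacci and Lucas numbers: $F_0=0$, $F_1=1$, $L_0=2$, $L_1=1$, and both satisfy $a_n=a_{n-1}+a_{n-2}$. *)

theory Defs
  imports
    "HOL-Number_Theory.Fib"
    "HOL-Computational_Algebra.Polynomial"
begin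

fun lucas :: "nat \<Rightarrow> nat" where
  "lucas 0 = 2"
| "lucas (Suc 0) = 1"
| "lucas (Suc (Suc n)) = lucas (Suc n) + lucas n"

(* The argument m is half the index: S_poly m is the polynomial S_{2m+1}, of degree 2m+1.
   The exponents s - m and -m are nonpositive integers, hence powi. *)
definition S_poly :: "nat \<Rightarrow> rat poly" where
  "S_poly m =
     (\<Sum>s = 0..m. monom
        (\<Sum>k = s..m. of_nat (1 + 2 * k) / of_nat (1 + 2 * s)
            * of_nat ((2 * m + 1) choose (m - k)) * of_nat ((k + s) choose (2 * s))
            * ((- 5) powi (int s - int m) / of_nat (lucas (2 * k + 1))))
        (2 * s + 1))
     - [: \<Sum>k = 0..m. (- 1) ^ (m - k) * of_nat ((2 * m + 1) choose (m - k))
            * (of_nat (fib (2 * k + 1)) / of_nat (lucas (2 * k + 1))) * 5 powi (- int m) :]"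

end

theory Submission
  imports Defs
begin

text \<open>
  The polynomial sums odd powers of Fibonacci numbers: by Binet's formulas,
  \<open>S(F(2n+1)) = F(2)^(2m+1) + F(4)^(2m+1) + ... + F(2n)^(2m+1)\<close> for every \<open>n\<close>, and these infinitely many
  values determine it. An integer polynomial with \<open>L(1) L(3) ... L(2m+1)\<close> times these values is found by
  induction: for \<open>x = F(2n+1)\<close>, \<open>w = F(2n-1)\<close>, \<open>y = F(2n)\<close> one has \<open>x - w = y\<close> and \<open>x w = 1 + y^2\<close>, so
  \<open>x^(2m+1) - w^(2m+1)\<close> is an odd integer polynomial in \<open>y\<close> with leading term \<open>L(2m+1) y^(2m+1)\<close>.
  Summing over \<open>n\<close> telescopes the left-hand side and expresses \<open>L(2m+1)\<close> times the power sum of exponent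
  \<open>2m+1\<close> through power sums of smaller odd exponents.
\<close>

subsection \<open>Binet formulas\<close>

definition golden :: real where "golden = (1 + sqrt 5) / 2"
definition golden_conj :: real where "golden_conj = (1 - sqrt 5) / 2"

lemma golden_mult: "golden * golden_conj = -1"
  by (simp add: golden_def golden_conj_def algebra_simps)

lemma golden_power2: "golden\<^sup>2 = golden + 1" "golden_conj\<^sup>2 = golden_conj + 1"
  by (simp_all add: golden_def golden_conj_def power2_eq_square field_simps)

lemma golden_mult_power: "golden ^ n * golden_conj ^ n = (-1) ^ n"
  by (simp add: golden_mult flip: power_mult_distrib)

lemma fib_binet: "sqrt 5 * real (fib n) = golden ^ n - golden_conj ^ n"
  using fib_closed_form[of n] by (simp add: golden_def golden_conj_def)

lemma lucas_binet: "real (lucas n) = golden ^ n + golden_conj ^ n"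
proof (induction n rule: lucas.induct)
  case (3 n)
  have "x ^ Suc (Suc n) = x ^ Suc n + x ^ n" if "x\<^sup>2 = x + 1" for x :: real
    using that by (simp add: power2_eq_square algebra_simps flip: mult.assoc)
  with 3 show ?case
    using golden_power2 by (simp del: power_Suc)
qed (simp_all add: golden_def golden_conj_def field_simps)

lemma lucas_pos: "lucas n > 0"
  by (induction n rule: lucas.induct) auto

text \<open>As \<open>q\<close> is odd, \<open>a = golden ^ q\<close> and
  \<open>b = golden_conj ^ q\<close> have product -1, so the cross terms of (a + b)(a^i - b^i)
  amount to -(a^(i-1) - b^(i-1)). This is the telescoping relation behind the Lucas
  denominators.\<close>

lemma lucas_mult_fib:
  assumes "odd q"
  shows "lucas q * fib (2 * Suc j * q) + fib ((2 * j + 1) * q) = fib ((2 * j + 3) * q)"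
proof -
  define a b where "a = golden ^ q" and "b = golden_conj ^ q"
  have ab: "a * b = -1"
    using assms by (simp add: a_def b_def golden_mult_power)
  have fib_q: "sqrt 5 * real (fib (i * q)) = a ^ i - b ^ i" for i
    unfolding fib_binet a_def b_def by (simp add: mult.commute flip: power_mult)
  have "(a + b) * (a ^ (2 * Suc j) - b ^ (2 * Suc j)) + (a ^ (2 * j + 1) - b ^ (2 * j + 1)) * (- (a * b))
      = a ^ (2 * j + 3) - b ^ (2 * j + 3)"
    by (simp add: algebra_simps power_add numeral_3_eq_3)
  then have "sqrt 5 * real (lucas q * fib (2 * Suc j * q) + fib ((2 * j + 1) * q)) = sqrt 5 * real (fib ((2 * j + 3) * q))"
    using fib_q[of "2 * Suc j"] fib_q[of "2 * j + 1"] fib_q[of "2 * j + 3"] ab lucas_binet[of q]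
    by (simp only: of_nat_add of_nat_mult distrib_left mult.left_commute[of "sqrt 5"] a_def b_def)
       simp
  then show ?thesis
    by (simp only: mult_cancel_left of_nat_eq_iff) simp
qed

subsection \<open>Odd powers and odd multiples\<close>

text \<open>The binomial terms of index \<open>m - k\<close> and \<open>m + 1 + k\<close> are
  paired: their binomial coefficients agree, and \<open>a * b = 1\<close> removes the factor
  \<open>a ^ (m - k) * b ^ (m - k)\<close> from each.\<close>

lemma odd_power_diff_expand:
  fixes a b :: "'a :: comm_ring_1"
  assumes "a * b = 1"
  shows "(a - b) ^ (2 * m + 1) =
    (\<Sum>k = 0..m. (-1) ^ (m - k) * of_nat ((2 * m + 1) choose (m - k)) * (a ^ (2 * k + 1) - b ^ (2 * k + 1)))"
proof -
  define t where "t i = of_nat ((2 * m + 1) choose i) * a ^ i * (- b) ^ (2 * m + 1 - i)" for i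
  have cancel: "a ^ i * b ^ i = 1" for i
    using assms by (simp flip: power_mult_distrib)
  have hi: "t (m + 1 + k) = (-1) ^ (m - k) * of_nat ((2 * m + 1) choose (m - k)) * a ^ (2 * k + 1)"
    if "k \<le> m" for k
  proof -
    have "m + 1 + k = (m - k) + (2 * k + 1)" "2 * m + 1 - (m + 1 + k) = m - k" using that by auto
    moreover have "(2 * m + 1) choose (m + 1 + k) = (2 * m + 1) choose (m - k)"
      using binomial_symmetric[of "m + 1 + k" "2 * m + 1"] that by simp
    ultimately have "t (m + 1 + k) = of_nat ((2 * m + 1) choose (m - k)) * (a ^ (m - k) * a ^ (2 * k + 1)) * (- b) ^ (m - k)"
      unfolding t_def by (simp only: power_add)
    also have "\<dots> = (-1) ^ (m - k) * of_nat ((2 * m + 1) choose (m - k)) * a ^ (2 * k + 1) * (a ^ (m - k) * b ^ (m - k))"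
      by (subst power_minus) (simp only: mult_ac)
    finally show ?thesis by (simp only: cancel mult_1_right)
  qed
  have lo: "t (m - k) = - ((-1) ^ (m - k) * of_nat ((2 * m + 1) choose (m - k)) * b ^ (2 * k + 1))"
    if "k \<le> m" for k
  proof -
    have e: "2 * m + 1 - (m - k) = (m - k) + (2 * k + 1)" using that by auto
    have "t (m - k) = of_nat ((2 * m + 1) choose (m - k)) * a ^ (m - k) * ((-1) ^ (m - k) * b ^ (m - k) * (- (b ^ (2 * k + 1))))"
      unfolding t_def e by (simp add: power_add power_minus[of b])
    also have "\<dots> = - ((-1) ^ (m - k) * of_nat ((2 * m + 1) choose (m - k)) * b ^ (2 * k + 1)) * (a ^ (m - k) * b ^ (m - k))"
      by (simp add: mult_ac)
    finally show ?thesis by (simp only: cancel mult_1_right)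
  qed
  have "(a - b) ^ (2 * m + 1) = (\<Sum>i\<le>2 * m + 1. t i)"
    using binomial_ring[of a "- b" "2 * m + 1"] by (simp add: t_def)
  also have "{..2 * m + 1} = (\<lambda>k. m - k) ` {0..m} \<union> (\<lambda>k. m + 1 + k) ` {0..m}"
  proof safe
    fix i assume "i \<le> 2 * m + 1" "i \<notin> (\<lambda>k. m + 1 + k) ` {0..m}"
    then have "i \<le> m"
      using image_eqI[of i "\<lambda>k. m + 1 + k" "i - (m + 1)" "{0..m}"] by fastforce
    then show "i \<in> (\<lambda>k. m - k) ` {0..m}"
      by (intro image_eqI[of _ _ "m - i"]) auto
  qed auto
  also have "(\<Sum>i\<in>\<dots>. t i) = (\<Sum>i\<in>(\<lambda>k. m - k) ` {0..m}. t i) + (\<Sum>i\<in>(\<lambda>k. m + 1 + k) ` {0..m}. t i)"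
    by (intro sum.union_disjoint) auto
  also have "\<dots> = (\<Sum>k = 0..m. t (m - k)) + (\<Sum>k = 0..m. t (m + 1 + k))"
    by (intro arg_cong2[of _ _ _ _ "(+)"] sum.reindex_cong[OF _ refl refl]) (auto simp: inj_on_def)
  also have "\<dots> = (\<Sum>k = 0..m. t (m + 1 + k) + t (m - k))"
    by (simp add: sum.distrib)
  also have "\<dots> = (\<Sum>k = 0..m. (-1) ^ (m - k) * of_nat ((2 * m + 1) choose (m - k)) * (a ^ (2 * k + 1) - b ^ (2 * k + 1)))"
    by (intro sum.cong refl) (simp only: hi lo atLeastAtMost_iff right_diff_distrib add_uminus_conv_diff)
  finally show ?thesis .
qed

text \<open>Even powers of \<open>golden\<close> and \<open>golden_conj\<close> have product 1, so
  the expansion applies to them. The factor \<open>5 ^ m\<close> is what the odd power of sqrt 5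
  leaves after one sqrt 5 is cancelled.\<close>

lemma fib_even_odd_power:
  "5 ^ m * int (fib (2 * n)) ^ (2 * m + 1) =
    (\<Sum>k = 0..m. (-1) ^ (m - k) * int ((2 * m + 1) choose (m - k)) * int (fib (2 * n * (2 * k + 1))))"
    (is "?l = ?r")
proof -
  define a b where "a = golden ^ (2 * n)" and "b = golden_conj ^ (2 * n)"
  have ab: "a * b = 1"
    by (simp add: a_def b_def golden_mult_power)
  have fib_n: "sqrt 5 * real (fib (2 * n * i)) = a ^ i - b ^ i" for i
    by (simp add: fib_binet a_def b_def flip: power_mult)
  have "sqrt 5 * real_of_int ?l = (sqrt 5 * real (fib (2 * n * 1))) ^ (2 * m + 1)"
    by (simp add: power_mult_distrib power_mult)
  also have "\<dots> = (a - b) ^ (2 * m + 1)"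
    by (simp only: fib_n power_one_right)
  also have "\<dots> = sqrt 5 * real_of_int ?r"
    unfolding odd_power_diff_expand[OF ab] fib_n[symmetric]
    by (simp add: sum_distrib_left mult_ac)
  finally have "real_of_int ?l = real_of_int ?r" by simp
  then show ?thesis by (simp only: of_int_eq_iff)
qed

text \<open>The ratio (1 + 2k)/(1 + 2s) * C(k+s, 2s) from \<open>S_poly\<close>, in a form that is
  visibly an integer and obeys recurrences by Pascal's rule.\<close>

definition mult_coeff :: "nat \<Rightarrow> nat \<Rightarrow> nat" where
  "mult_coeff k s = ((k + s) choose (2 * s)) + 2 * ((k + s) choose (2 * s + 1))"

lemma mult_coeff_eq_0: "k < s \<Longrightarrow> mult_coeff k s = 0"
  by (simp add: mult_coeff_def)

text \<open>Since (2s+1) C(k+s, 2s+1) = (k-s) C(k+s, 2s) for s \<le> k, the left side is (2s+1 +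
  2(k-s)) C(k+s, 2s).\<close>

lemma mult_coeff_fraction: "(2 * s + 1) * mult_coeff k s = (2 * k + 1) * ((k + s) choose (2 * s))"
proof (cases "s \<le> k")
  case True
  then obtain d where d: "k = s + d" using le_Suc_ex by blast
  have "(2 * s + 1) * ((k + s) choose (2 * s + 1)) = (k - s) * ((k + s) choose (2 * s))"
    using binomial_absorb_comp[of "k + s" "2 * s"] binomial_absorption[of "2 * s" "k + s"] True
    by (simp add: d)
  then show ?thesis
    by (simp add: mult_coeff_def algebra_simps d)
qed (simp add: mult_coeff_eq_0)

lemma mult_coeff_rec_0: "mult_coeff (Suc (Suc k)) 0 + mult_coeff k 0 = 2 * mult_coeff (Suc k) 0"
  by (simp add: mult_coeff_def)

lemma mult_coeff_rec_Suc:
  "mult_coeff (Suc (Suc k)) (Suc s) + mult_coeff k (Suc s)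
    = 2 * mult_coeff (Suc k) (Suc s) + mult_coeff (Suc k) s"
  by (simp add: mult_coeff_def)

text \<open>A Chebyshev-type family: for ab = -1 it gives (a^(2k+1) - b^(2k+1))/(a - b) in terms of
  y = (a - b)^2, and the factor y - 2 is a^2 + b^2.\<close>

fun mult_poly :: "nat \<Rightarrow> int poly" where
  "mult_poly 0 = 1"
| "mult_poly (Suc 0) = [:-3, 1:]"
| "mult_poly (Suc (Suc k)) = [:-2, 1:] * mult_poly (Suc k) - mult_poly k"

lemma coeff_mult_poly: "coeff (mult_poly k) s = (-1) ^ (k + s) * int (mult_coeff k s)"
proof (induction k arbitrary: s rule: mult_poly.induct)
  case 1
  show ?case by (cases "s = 0") (simp_all add: mult_coeff_eq_0, simp add: mult_coeff_def)
next
  case (2 s)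
  consider "s = 0" | "s = 1" | r where "s = Suc (Suc r)"
    by (metis One_nat_def not0_implies_Suc)
  then show ?case
    by cases (simp_all add: mult_coeff_eq_0, simp_all add: mult_coeff_def numeral_2_eq_2 numeral_3_eq_3)
next
  case (3 k)
  show ?case
  proof (cases s)
    case 0
    have "int (mult_coeff (Suc (Suc k)) 0) = 2 * int (mult_coeff (Suc k) 0) - int (mult_coeff k 0)"
      using mult_coeff_rec_0[of k] by linarith
    then have "coeff (mult_poly (Suc (Suc k))) 0 = (-1) ^ k * int (mult_coeff (Suc (Suc k)) 0)"
      by (simp only:) (simp add: 3 algebra_simps)
    with 0 show ?thesis by simp
  next
    case (Suc r)
    have "int (mult_coeff (Suc (Suc k)) (Suc r))
        = 2 * int (mult_coeff (Suc k) (Suc r)) + int (mult_coeff (Suc k) r) - int (mult_coeff k (Suc r))"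
      using mult_coeff_rec_Suc[of k r] by linarith
    then have "coeff (mult_poly (Suc (Suc k))) (Suc r) = - ((-1) ^ (k + r) * int (mult_coeff (Suc (Suc k)) (Suc r)))"
      by (simp only:) (simp add: 3 algebra_simps)
    with Suc show ?thesis by simp
  qed
qed

lemma poly_eq_sum_of_degree_le:
  fixes p :: "'a :: comm_semiring_1 poly"
  assumes "\<And>i. i > n \<Longrightarrow> coeff p i = 0"
  shows "poly p x = (\<Sum>i = 0..n. coeff p i * x ^ i)"
proof -
  have "degree p \<le> n"
    using assms by (intro degree_le) auto
  then show ?thesis
    unfolding poly_altdef atLeast0AtMost by (intro sum.mono_neutral_left) (auto simp: coeff_eq_0)
qed

lemma power_diff_mult_poly:
  fixes a b :: real
  assumes "a * b = -1" and y_eq: "of_int y = (a - b)\<^sup>2"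
  shows "(a - b) * of_int (poly (mult_poly k) y) = a ^ (2 * k + 1) - b ^ (2 * k + 1)"
proof (induction k rule: mult_poly.induct)
  case 2
  have "a ^ 3 - b ^ 3 = (a - b) * ((a - b)\<^sup>2 + 3 * (a * b))"
    by (simp add: algebra_simps power2_eq_square power3_eq_cube)
  then show ?case
    unfolding assms(1) y_eq[symmetric] by simp
next
  case (3 k)
  have y: "of_int y = a\<^sup>2 + b\<^sup>2 + 2"
    using assms by (simp add: power2_diff)
  have "(a - b) * of_int (poly (mult_poly (Suc (Suc k))) y) =
    (of_int y - 2) * ((a - b) * of_int (poly (mult_poly (Suc k)) y)) - (a - b) * of_int (poly (mult_poly k) y)"
    by (simp add: algebra_simps)
  \<comment> \<open>The factor \<open>(a * b)\<^sup>2\<close>, which equals 1, is inserted so that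
    the next equation is an identity in free \<open>a\<close> and \<open>b\<close>.\<close>
  also have "\<dots> = (a\<^sup>2 + b\<^sup>2) * (a ^ (2 * Suc k + 1) - b ^ (2 * Suc k + 1)) - (a * b)\<^sup>2 * (a ^ (2 * k + 1) - b ^ (2 * k + 1))"
    by (simp only: 3 y) (simp add: assms)
  also have "\<dots> = a ^ (2 * Suc (Suc k) + 1) - b ^ (2 * Suc (Suc k) + 1)"
    by (simp add: algebra_simps power2_eq_square)
  finally show ?case .
qed simp

text \<open>For odd \<open>N\<close>, Binet's formula gives (a - b)^2 = 5 F(N)^2 with a, b the
  \<open>N\<close>-th powers of \<open>golden\<close> and \<open>golden_conj\<close>, whose product
  is -1.\<close>

lemma fib_odd_multiple:
  assumes "odd N"
  shows "int (fib (N * (2 * k + 1))) = int (fib N) * poly (mult_poly k) (5 * int (fib N) ^ 2)"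
proof -
  define a b where "a = golden ^ N" and "b = golden_conj ^ N"
  have ab: "a * b = -1"
    using assms by (simp add: a_def b_def golden_mult_power)
  have fib_N: "sqrt 5 * real (fib (N * i)) = a ^ i - b ^ i" for i
    by (simp add: fib_binet a_def b_def flip: power_mult)
  have "(a - b)\<^sup>2 = (sqrt 5 * real (fib N))\<^sup>2"
    using fib_N[of 1] by simp
  then have "of_int (5 * int (fib N) ^ 2) = (a - b)\<^sup>2"
    by (simp add: power_mult_distrib)
  then have "sqrt 5 * real (fib (N * (2 * k + 1))) = (a - b) * of_int (poly (mult_poly k) (5 * int (fib N) ^ 2))"
    unfolding fib_N by (rule power_diff_mult_poly[OF ab, symmetric])
  also have "a - b = sqrt 5 * real (fib N)"
    using fib_N[of 1] by simp
  finally have "real_of_int (int (fib (N * (2 * k + 1)))) = real_of_int (int (fib N) * poly (mult_poly k) (5 * int (fib N) ^ 2))"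
    by simp
  then show ?thesis by (simp only: of_int_eq_iff)
qed

text \<open>The range ends at \<open>m\<close> instead of \<open>k\<close>, the extra coefficients
  being 0, so that the sums over \<open>k\<close> and \<open>s\<close> can later be
  interchanged.\<close>

lemma fib_odd_multiple_sum:
  assumes "odd N" "k \<le> m"
  shows "int (fib (N * (2 * k + 1))) =
    (\<Sum>s = 0..m. (-1) ^ (k + s) * int (mult_coeff k s) * 5 ^ s * int (fib N) ^ (2 * s + 1))"
proof -
  have "poly (mult_poly k) y = (\<Sum>s = 0..m. (-1) ^ (k + s) * int (mult_coeff k s) * y ^ s)" for y
    using poly_eq_sum_of_degree_le[of m "mult_poly k"] assms
    by (simp add: coeff_mult_poly mult_coeff_eq_0)
  moreover have "int (fib N) * ((-1) ^ (k + s) * int (mult_coeff k s) * (5 * int (fib N) ^ 2) ^ s)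
      = (-1) ^ (k + s) * int (mult_coeff k s) * 5 ^ s * int (fib N) ^ (2 * s + 1)" for s
    by (simp add: power_mult_distrib flip: power_mult)
  ultimately show ?thesis
    unfolding fib_odd_multiple[OF assms(1)] by (simp only: sum_distrib_left)
qed

subsection \<open>Values of the polynomial at Fibonacci numbers\<close>

definition fib_power_sum :: "nat \<Rightarrow> nat \<Rightarrow> int" where
  "fib_power_sum m n = (\<Sum>j = 1..n. int (fib (2 * j)) ^ (2 * m + 1))"

lemma sum_fib_multiples:
  assumes "odd q"
  shows "(\<Sum>j = 1..n. int (fib (2 * j * q))) * int (lucas q) = int (fib ((2 * n + 1) * q)) - int (fib q)"
proof (induction n)
  case (Suc n)
  have "int (fib ((2 * Suc n + 1) * q)) = int (lucas q) * int (fib (2 * Suc n * q)) + int (fib ((2 * n + 1) * q))"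
  proof -
    have "2 * Suc n + 1 = 2 * n + 3" by simp
    then show ?thesis
      by (simp only: lucas_mult_fib[OF assms] flip: of_nat_mult of_nat_add)
  qed
  with Suc show ?case by (simp add: algebra_simps)
qed simp

text \<open>At x = F(2n+1) the sum over s collapses to F((2n+1)(2k+1)), and the constant term
  subtracts F(2k+1). The difference is L(2k+1) times the sum of F(2j(2k+1)) over j, which cancels
  the denominator; summing over k then yields the powers F(2j)^(2m+1).\<close>

lemma poly_S_poly_fib:
  "poly (S_poly m) (of_nat (fib (2 * n + 1))) = of_int (fib_power_sum m n)"
proof -
  define x where "x = (of_nat (fib (2 * n + 1)) :: rat)"
  define w where "w k = (-1) ^ (m - k) * of_nat ((2 * m + 1) choose (m - k)) / (5 ^ m * of_nat (lucas (2 * k + 1)) :: rat)" for k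
  have pos: "of_nat (lucas (2 * k + 1)) \<noteq> (0 :: rat)" for k
    using lucas_pos[of "2 * k + 1"] by simp
  have summand: "of_nat (1 + 2 * k) / of_nat (1 + 2 * s)
            * of_nat ((2 * m + 1) choose (m - k)) * of_nat ((k + s) choose (2 * s))
            * ((- 5) powi (int s - int m) / of_nat (lucas (2 * k + 1)))
     = w k * ((-1) ^ (k + s) * of_nat (mult_coeff k s) * 5 ^ s)" if "k \<le> m" "s \<le> m" for k s
  proof -
    \<comment> \<open>The sign is split in two: \<open>(-1) ^ (m - k)\<close> goes into
      \<open>w k\<close>, which collects what is independent of \<open>s\<close>, and
      \<open>(-1) ^ (k + s)\<close> is the sign of the coefficient of
      \<open>mult_poly k\<close>.\<close>
    have A: "(- 5 :: rat) powi (int s - int m) = (-1) ^ (m - k) * (-1) ^ (k + s) * 5 ^ s / 5 ^ m"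
    proof -
      have "(- 5 :: rat) powi (int s - int m) = (-5) ^ s / (-5) ^ m"
        by (simp add: power_int_diff)
      also have "\<dots> = (-1) ^ s * 5 ^ s / ((-1) ^ m * 5 ^ m)"
        by (simp add: power_minus[of 5])
      also have "\<dots> = (-1) ^ m * (-1) ^ s * 5 ^ s / 5 ^ m"
        by (cases "even m") simp_all
      also have "(-1 :: rat) ^ m = (-1) ^ (m - k) * (-1) ^ k"
        using that by (simp flip: power_add)
      finally show ?thesis by (simp add: power_add)
    qed
    have "of_nat (1 + 2 * s) * of_nat (mult_coeff k s) = (of_nat (1 + 2 * k) * of_nat ((k + s) choose (2 * s)) :: rat)"
      using mult_coeff_fraction[of s k] by (metis add.commute of_nat_mult)
    moreover have "of_nat (1 + 2 * s) \<noteq> (0 :: rat)" by (simp only: of_nat_eq_0_iff)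
    ultimately have B: "of_nat (1 + 2 * k) / of_nat (1 + 2 * s) * of_nat ((k + s) choose (2 * s)) = (of_nat (mult_coeff k s) :: rat)"
      by (simp add: nonzero_divide_eq_eq mult.commute del: of_nat_add of_nat_Suc of_nat_mult)
    show ?thesis
      unfolding A w_def B[symmetric] by (simp add: mult_ac)
  qed
  have const: "(-1) ^ (m - k) * of_nat ((2 * m + 1) choose (m - k))
      * (of_nat (fib (2 * k + 1)) / of_nat (lucas (2 * k + 1))) * 5 powi (- int m) = w k * of_nat (fib (2 * k + 1))" for k
    by (simp add: w_def power_int_minus field_simps)
  define c where "c s = (\<Sum>k = s..m. of_nat (1 + 2 * k) / of_nat (1 + 2 * s)
            * of_nat ((2 * m + 1) choose (m - k)) * of_nat ((k + s) choose (2 * s))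
            * ((- 5) powi (int s - int m) / of_nat (lucas (2 * k + 1))) :: rat)" for s
  \<comment> \<open>The sum may start at 0 because \<open>mult_coeff k s\<close> vanishes for k <
    s.\<close>
  have c: "c s = (\<Sum>k = 0..m. w k * ((-1) ^ (k + s) * of_nat (mult_coeff k s) * 5 ^ s))" if "s \<le> m" for s
    unfolding c_def using that
    by (intro sum.mono_neutral_cong_left summand) (auto simp: mult_coeff_eq_0)
  have "poly (S_poly m) x = (\<Sum>s = 0..m. c s * x ^ (2 * s + 1)) - (\<Sum>k = 0..m. w k * of_nat (fib (2 * k + 1)))"
    unfolding c_def const[symmetric] S_poly_def by (simp add: poly_sum poly_monom)
  also have "(\<Sum>s = 0..m. c s * x ^ (2 * s + 1)) =
      (\<Sum>s = 0..m. (\<Sum>k = 0..m. w k * ((-1) ^ (k + s) * of_nat (mult_coeff k s) * 5 ^ s)) * x ^ (2 * s + 1))"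
    by (intro sum.cong refl) (simp only: c atLeastAtMost_iff)
  also have "\<dots> = (\<Sum>k = 0..m. w k * (\<Sum>s = 0..m. (-1) ^ (k + s) * of_nat (mult_coeff k s) * 5 ^ s * x ^ (2 * s + 1)))"
    unfolding sum_distrib_right sum_distrib_left by (subst sum.swap) (simp add: mult_ac)
  also have "\<dots> = (\<Sum>k = 0..m. w k * of_nat (fib ((2 * n + 1) * (2 * k + 1))))"
  proof (intro sum.cong refl arg_cong2[of _ _ _ _ "(*)"])
    fix k assume "k \<in> {0..m}"
    then have "rat_of_int (int (fib ((2 * n + 1) * (2 * k + 1)))) =
        of_int (\<Sum>s = 0..m. (-1) ^ (k + s) * int (mult_coeff k s) * 5 ^ s * int (fib (2 * n + 1)) ^ (2 * s + 1))"
      by (subst fib_odd_multiple_sum[of _ _ m]) auto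
    then show "(\<Sum>s = 0..m. (-1) ^ (k + s) * of_nat (mult_coeff k s) * 5 ^ s * x ^ (2 * s + 1)) = of_nat (fib ((2 * n + 1) * (2 * k + 1)))"
      by (simp add: x_def)
  qed
  finally have "poly (S_poly m) x = (\<Sum>k = 0..m. w k * of_int (int (fib ((2 * n + 1) * (2 * k + 1))) - int (fib (2 * k + 1))))"
    by (simp add: sum_subtractf right_diff_distrib)
  also have "\<dots> = (\<Sum>k = 0..m. w k * of_nat (lucas (2 * k + 1)) * (\<Sum>j = 1..n. of_nat (fib (2 * j * (2 * k + 1)))))"
    by (subst sum_fib_multiples[symmetric]) (simp_all add: mult_ac)
  also have "\<dots> = (\<Sum>k = 0..m. (-1) ^ (m - k) * of_nat ((2 * m + 1) choose (m - k)) / 5 ^ m * (\<Sum>j = 1..n. of_nat (fib (2 * j * (2 * k + 1)))))"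
    using pos by (simp add: w_def)
  also have "\<dots> = (\<Sum>j = 1..n. of_int (\<Sum>k = 0..m. (-1) ^ (m - k) * int ((2 * m + 1) choose (m - k)) * int (fib (2 * j * (2 * k + 1)))) / 5 ^ m)"
    unfolding sum_distrib_left by (subst sum.swap) (simp add: sum_divide_distrib)
  also have "\<dots> = of_int (fib_power_sum m n)"
    unfolding fib_even_odd_power[symmetric] fib_power_sum_def by simp
  finally show ?thesis by (simp add: x_def)
qed

subsection \<open>Integrality\<close>

text \<open>The quotient (x^(2s+1) - w^(2s+1))/y as a polynomial in t = y^2, where x - w = y and xw
  = 1 + y^2. The factors are x^2 + w^2 = 2 + 3t and (xw)^2 = 1 + 2t + t^2.\<close>

fun step_poly :: "nat \<Rightarrow> int poly" where
  "step_poly 0 = 1"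
| "step_poly (Suc 0) = [:3, 4:]"
| "step_poly (Suc (Suc s)) = [:2, 3:] * step_poly (Suc s) - [:1, 2, 1:] * step_poly s"

lemma degree_step_poly: "degree (step_poly s) \<le> s"
proof (induction s rule: step_poly.induct)
  case (3 s)
  have "degree ([:2, 3:] * step_poly (Suc s)) \<le> Suc (Suc s)"
    using 3 degree_mult_le[of "[:2, 3:]" "step_poly (Suc s)"] by simp
  moreover have "degree ([:1, 2, 1:] * step_poly s) \<le> Suc (Suc s)"
    using 3 degree_mult_le[of "[:1, 2, 1:]" "step_poly s"] by simp
  ultimately show ?case by (simp add: degree_diff_le)
qed auto

text \<open>By the degree bound the top coefficients satisfy c(s+2) = 3 c(s+1) - c(s), as do the
  Lucas numbers of odd index. This is why exponent 2m+1 brings in only the new factor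
  L(2m+1).\<close>

lemma coeff_step_poly: "coeff (step_poly s) s = int (lucas (2 * s + 1))"
proof (induction s rule: step_poly.induct)
  case (3 s)
  have "coeff (step_poly (Suc s)) (Suc (Suc s)) = 0" "coeff (step_poly s) (Suc s) = 0" "coeff (step_poly s) (Suc (Suc s)) = 0"
    using degree_step_poly[of s] degree_step_poly[of "Suc s"] by (auto intro: coeff_eq_0)
  with 3 show ?case by (simp add: algebra_simps)
qed (simp_all add: numeral_2_eq_2 numeral_3_eq_3)

lemma odd_power_diff_step_poly:
  fixes x w y :: int
  assumes "x - w = y" "x * w = 1 + y\<^sup>2"
  shows "x ^ (2 * s + 1) - w ^ (2 * s + 1) = y * poly (step_poly s) (y\<^sup>2)"
proof (induction s rule: step_poly.induct)
  case 2
  have "x ^ 3 - w ^ 3 = (x - w) * ((x - w)\<^sup>2 + 3 * (x * w))"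
    by (simp add: algebra_simps power2_eq_square power3_eq_cube)
  then show ?case unfolding assms by (simp add: algebra_simps power2_eq_square power3_eq_cube)
next
  case (3 s)
  have sq: "x\<^sup>2 + w\<^sup>2 = 2 + 3 * y\<^sup>2"
  proof -
    have "x\<^sup>2 + w\<^sup>2 = (x - w)\<^sup>2 + 2 * (x * w)"
      by (simp add: algebra_simps power2_eq_square)
    then show ?thesis by (simp add: assms)
  qed
  have "x ^ (2 * Suc (Suc s) + 1) - w ^ (2 * Suc (Suc s) + 1) =
     (x\<^sup>2 + w\<^sup>2) * (x ^ (2 * Suc s + 1) - w ^ (2 * Suc s + 1)) - (x * w)\<^sup>2 * (x ^ (2 * s + 1) - w ^ (2 * s + 1))"
    by (simp add: algebra_simps power2_eq_square)
  also have "\<dots> = y * poly (step_poly (Suc (Suc s))) (y\<^sup>2)"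
    unfolding 3 sq assms by (simp add: algebra_simps power2_eq_square)
  finally show ?case .
qed (use assms in simp)

lemma fib_cassini_odd: "fib (2 * n + 3) * fib (2 * n + 1) = 1 + (fib (2 * n + 2))\<^sup>2"
  by (induction n) (simp_all add: numeral_3_eq_3 power2_eq_square algebra_simps)

text \<open>The subtracted 1 is F(1)^(2s+1), the starting value of the telescope.\<close>

lemma fib_odd_power_telescope:
  "int (fib (2 * n + 1)) ^ (2 * s + 1) - 1 = (\<Sum>j = 0..s. coeff (step_poly s) j * fib_power_sum j n)"
proof (induction n)
  case (Suc n)
  define x w y where "x = int (fib (2 * n + 3))" and "w = int (fib (2 * n + 1))" and "y = int (fib (2 * n + 2))"
  have "x - w = y"
    by (simp add: x_def w_def y_def numeral_3_eq_3)
  moreover have "x * w = 1 + y\<^sup>2"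
    using arg_cong[OF fib_cassini_odd[of n], of int] by (simp add: x_def w_def y_def)
  ultimately have "x ^ (2 * s + 1) - w ^ (2 * s + 1) = y * poly (step_poly s) (y\<^sup>2)"
    by (rule odd_power_diff_step_poly)
  also have "\<dots> = (\<Sum>j = 0..s. coeff (step_poly s) j * y ^ (2 * j + 1))"
    using poly_eq_sum_of_degree_le[of s "step_poly s" "y\<^sup>2"] degree_step_poly[of s]
    by (simp add: coeff_eq_0 sum_distrib_left mult.left_commute flip: power_mult)
  finally have "x ^ (2 * s + 1) - 1 = (\<Sum>j = 0..s. coeff (step_poly s) j * (fib_power_sum j n + y ^ (2 * j + 1)))"
    using Suc by (simp add: w_def sum.distrib distrib_left)
  moreover have "fib_power_sum j (Suc n) = fib_power_sum j n + y ^ (2 * j + 1)" for j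
    by (simp add: fib_power_sum_def y_def)
  ultimately show ?case by (simp add: x_def numeral_3_eq_3)
qed (simp add: fib_power_sum_def)

text \<open>The telescoped identity is solved for its top term, L(2m+1) times the power sum of
  exponent 2m+1; multiplying by L(1) L(3) ... L(2m-1) makes the lower power sums integer polynomials
  by induction.\<close>

lemma int_poly_fib_power_sum:
  "\<exists>T :: int poly. \<forall>n. poly T (int (fib (2 * n + 1))) = int (\<Prod>k = 0..m. lucas (2 * k + 1)) * fib_power_sum m n"
proof (induction m rule: less_induct)
  case (less m)
  define P where "P m = int (\<Prod>k = 0..m. lucas (2 * k + 1))" for m
  define Q where "Q = int (\<Prod>k < m. lucas (2 * k + 1))"
  from less obtain T :: "nat \<Rightarrow> int poly" where
    T: "poly (T j) (int (fib (2 * n + 1))) = P j * fib_power_sum j n" if "j < m" for j n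
    unfolding P_def by metis
  \<comment> \<open>\<open>P j\<close> is a subproduct of \<open>Q\<close>, so rescaling
    \<open>T j\<close> from the factor \<open>P j\<close> to the factor \<open>Q\<close> keeps its
    coefficients integral.\<close>
  have "P j dvd Q" if "j < m" for j
    unfolding P_def Q_def of_nat_dvd_iff using that by (intro prod_dvd_prod_subset) auto
  then have Q: "Q div P j * P j = Q" if "j < m" for j
    using that by simp
  have Pm: "P m = Q * int (lucas (2 * m + 1))"
    by (simp add: P_def Q_def atLeast0AtMost flip: lessThan_Suc_atMost)
  define U where "U = smult Q (monom 1 (2 * m + 1) - 1) - (\<Sum>j < m. smult (coeff (step_poly m) j * (Q div P j)) (T j))"
  have "poly U (int (fib (2 * n + 1))) = P m * fib_power_sum m n" for n
  proof -
    have "poly U (int (fib (2 * n + 1))) = Q * (int (fib (2 * n + 1)) ^ (2 * m + 1) - 1)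
        - (\<Sum>j < m. coeff (step_poly m) j * (Q div P j * P j) * fib_power_sum j n)"
      using T by (simp add: U_def poly_sum poly_monom mult_ac)
    also have "(\<Sum>j < m. coeff (step_poly m) j * (Q div P j * P j) * fib_power_sum j n)
        = Q * (\<Sum>j < m. coeff (step_poly m) j * fib_power_sum j n)"
      unfolding sum_distrib_left by (intro sum.cong refl) (simp only: Q lessThan_iff, simp only: mult_ac)
    also have "int (fib (2 * n + 1)) ^ (2 * m + 1) - 1
       = (\<Sum>j < m. coeff (step_poly m) j * fib_power_sum j n) + int (lucas (2 * m + 1)) * fib_power_sum m n"
      unfolding fib_odd_power_telescope by (simp add: atLeast0AtMost coeff_step_poly flip: lessThan_Suc_atMost)
    finally show ?thesis by (simp add: Pm algebra_simps)
  qed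
  then show ?case unfolding P_def by blast
qed

text \<open>This supplies infinitely many distinct evaluation points; consecutive values differ by
  F(2n+2) > 0.\<close>

lemma strict_mono_fib_odd: "strict_mono (\<lambda>n. fib (2 * n + 1))"
  by (rule strict_mono_Suc_iff[THEN iffD2]) (simp add: fib_neq_0_nat)

theorem theorem2p1:
  fixes m :: nat
  assumes "m > 0"
  shows "\<forall>i. coeff (smult (of_nat (\<Prod>k = 0..m. lucas (2 * k + 1))) (S_poly m)) i \<in> \<int>"
proof -
  define P where "P = (\<Prod>k = 0..m. lucas (2 * k + 1))"
  define p where "p = smult (of_nat P) (S_poly m)"
  obtain T :: "int poly" where T: "poly T (int (fib (2 * n + 1))) = int P * fib_power_sum m n" for n
    using int_poly_fib_power_sum[of m] by (auto simp: P_def)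
  have agree: "poly p (of_nat (fib (2 * n + 1))) = poly (map_poly of_int T) (of_nat (fib (2 * n + 1)))" for n
  proof -
    have "poly (map_poly rat_of_int T) (of_int (int (fib (2 * n + 1)))) = of_int (int P * fib_power_sum m n)"
      unfolding T[symmetric] by (simp add: poly_altdef degree_map_poly coeff_map_poly)
    then show ?thesis using poly_S_poly_fib[of m n] by (simp add: p_def)
  qed
  have "p = map_poly of_int T"
  proof (rule ccontr)
    assume "p \<noteq> map_poly of_int T"
    \<comment> \<open>A nonzero difference would have finitely many roots, yet it vanishes at every
      F(2n+1).\<close>
    then have "finite {x. poly (p - map_poly of_int T) x = 0}"
      by (intro poly_roots_finite) simp
    moreover have "range (\<lambda>n. rat_of_nat (fib (2 * n + 1))) \<subseteq> {x. poly (p - map_poly of_int T) x = 0}"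
      using agree by auto
    ultimately have "finite (range (\<lambda>n. rat_of_nat (fib (2 * n + 1))))"
      by (rule rev_finite_subset)
    moreover have "inj (\<lambda>n. rat_of_nat (fib (2 * n + 1)))"
      using strict_mono_imp_inj_on[OF strict_mono_fib_odd] by (auto simp: inj_on_def)
    ultimately show False
      using finite_imageD infinite_UNIV_nat by blast
  qed
  then show ?thesis
    unfolding P_def[symmetric] p_def[symmetric] by (simp add: coeff_map_poly)
qed

end
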